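(* For all positive integers $\nu$ and all non-zero real numbers $m$ (in particular for all non-zero integers $m$), $$4(\nu+1)m^2+K_{n=1}^{\infty}\frac{4m^2n(n+\nu)}{4m^2(n+1)(n+\nu+1)-1}=\frac{1}{1-\nu!\,(2m)^{\nu}J_{\nu}\left(\frac1m\right)},$$ where $J_\nu(x)$ is the Bessel function of the first kind of order $\nu$.
   Context: For sequences $\{a_n\}_{n\ge1}$, $\{b_n\}_{n\ge1}$, $K_{n=1}^{N}\frac{a_n}{b_n}$ denotes the finite continued fraction $\cfrac{a_1}{b_1+\cfrac{a_2}{b_2+\cdots+\cfrac{a_N}{b_N}}}$, written as $A_N/B_N$, where $A_{-1}=1$, $A_0=0$, $B_{-1}=0$, $B_0=1$, and $A_n=b_nA_{n-1}+a_nA_{n-2}$, $B_n=b_nB_{n-1}+a_nB_{n-2}$ for $n\ge1$. $K_{n=1}^{\infty}\frac{a_n}{b_n}$ denotes $\lim_{N\to\infty}A_N/B_N$; a stated value means that $B_N\neq0$ for all large $N$ and that the limit exists and has that value. The Bessel function is $J_\nu(x)=\sum_{k=0}^{\infty}\frac{(-1)^k}{k!\,(k+\nu)!}\left(\frac x2\right)^{2k+\nu}$. *)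

theory Defs
  imports Complex_Main
begin

text \<open>
  The coefficients are \<open>a 1, a 2, \<dots>\<close> and \<open>b 1, b 2, \<dots>\<close>; the values \<open>a 0\<close> and \<open>b 0\<close> are never
  used. The initial values at index \<open>-1\<close> (1 for the numerators, 0 for the denominators)
  enter through the equations for index 1.
\<close>

fun cf_num :: "(nat \<Rightarrow> 'a::real_normed_field) \<Rightarrow> (nat \<Rightarrow> 'a) \<Rightarrow> nat \<Rightarrow> 'a" where
  "cf_num a b 0 = 0"
| "cf_num a b (Suc 0) = b 1 * cf_num a b 0 + a 1 * 1"
| "cf_num a b (Suc (Suc n)) =
     b (Suc (Suc n)) * cf_num a b (Suc n) + a (Suc (Suc n)) * cf_num a b n"

fun cf_denom :: "(nat \<Rightarrow> 'a::real_normed_field) \<Rightarrow> (nat \<Rightarrow> 'a) \<Rightarrow> nat \<Rightarrow> 'a" where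
  "cf_denom a b 0 = 1"
| "cf_denom a b (Suc 0) = b 1 * cf_denom a b 0 + a 1 * 0"
| "cf_denom a b (Suc (Suc n)) =
     b (Suc (Suc n)) * cf_denom a b (Suc n) + a (Suc (Suc n)) * cf_denom a b n"

definition cf_convergent :: "(nat \<Rightarrow> 'a::real_normed_field) \<Rightarrow> (nat \<Rightarrow> 'a) \<Rightarrow> bool" where
  "cf_convergent a b \<longleftrightarrow>
     (\<forall>\<^sub>F N in sequentially. cf_denom a b N \<noteq> 0) \<and>
     convergent (\<lambda>N. cf_num a b N / cf_denom a b N)"

text \<open>Meaningful only together with \<^const>\<open>cf_convergent\<close>.\<close>

definition cf_value :: "(nat \<Rightarrow> 'a::real_normed_field) \<Rightarrow> (nat \<Rightarrow> 'a) \<Rightarrow> 'a" where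
  "cf_value a b = lim (\<lambda>N. cf_num a b N / cf_denom a b N)"

definition bessel_J :: "nat \<Rightarrow> real \<Rightarrow> real" where
  "bessel_J \<nu> x = (\<Sum>k. (-1) ^ k / (fact k * fact (k + \<nu>)) * (x / 2) ^ (2 * k + \<nu>))"

lemma summable_bessel_J:
  "summable (\<lambda>k. (-1) ^ k / (fact k * fact (k + \<nu>)) * (x / 2) ^ (2 * k + \<nu>) :: real)"
proof (rule summable_comparison_test')
  show "summable (\<lambda>k. \<bar>x / 2\<bar> ^ \<nu> * (inverse (fact k) * ((x / 2)\<^sup>2) ^ k))"
    by (intro summable_mult summable_exp)
  fix k :: nat
  have "1 / (fact k * fact (k + \<nu>)) \<le> (inverse (fact k) :: real)"
    by (simp add: field_simps)
  then have "1 / (fact k * fact (k + \<nu>)) * (\<bar>x / 2\<bar> ^ \<nu> * ((x / 2)\<^sup>2) ^ k)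
      \<le> inverse (fact k) * (\<bar>x / 2\<bar> ^ \<nu> * ((x / 2)\<^sup>2) ^ k)"
    by (rule mult_right_mono) simp
  moreover have "\<bar>x / 2\<bar> ^ (2 * k + \<nu>) = \<bar>x / 2\<bar> ^ \<nu> * ((x / 2)\<^sup>2) ^ k"
    by (subst power_add, subst power_mult) (simp only: power2_abs mult.commute)
  ultimately show "norm ((-1) ^ k / (fact k * fact (k + \<nu>)) * (x / 2) ^ (2 * k + \<nu>))
      \<le> \<bar>x / 2\<bar> ^ \<nu> * (inverse (fact k) * ((x / 2)\<^sup>2) ^ k)"
    by (simp only: real_norm_def abs_mult abs_divide power_abs abs_minus_cancel abs_one
        power_one abs_of_nonneg[OF fact_ge_zero] mult.left_commute)
qed

end

theory Submission
  imports Defs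
begin

text \<open>
  With \<open>c n = 4 m\<^sup>2 n (n + \<nu>)\<close> the continued fraction has coefficients \<open>a n = c n\<close> and
  \<open>b n = c (n + 1) - 1\<close>, so by Euler's correspondence \<open>c 1\<close> plus its \<open>N\<close>-th convergent is the
  reciprocal of a partial sum of \<open>1 / c 1 - 1 / (c 1 * c 2) + \<dots>\<close>, whose sum is
  \<open>1 - \<nu>! (2 m)\<^sup>\<nu> J\<^sub>\<nu> (1 / m)\<close>. That this does not vanish is an energy argument: in the variable
  \<open>t = 1 / (2 m)\<^sup>2\<close> the normalised Bessel function \<open>g\<close> has \<open>g 0 = 1\<close> and solves
  \<open>t g'' + (\<nu> + 1) g' + g = 0\<close>, so \<open>g\<^sup>2 + t g'\<^sup>2\<close> has derivative \<open>- (2 \<nu> + 1) g'\<^sup>2\<close>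
  and therefore stays below its initial value 1.
\<close>

text \<open>Writing \<open>B\<close> for the denominators, the recurrence rearranges to
  \<open>B n - c (n+1) * B (n-1) = - (B (n-1) - c n * B (n-2))\<close>, so this difference is
  \<open>(-1) ^ n\<close>. Division by \<open>prod c {1..n+1}\<close> makes it the increment of an
  alternating series.\<close>

lemma cf_denom_euler:
  fixes c :: "nat \<Rightarrow> 'a::real_normed_field"
  assumes "\<And>n. n > 0 \<Longrightarrow> c n \<noteq> 0"
  shows "cf_denom c (\<lambda>n. c (Suc n) - 1) n =
    prod c {1..Suc n} * (1 - (\<Sum>k\<le>Suc n. (-1) ^ k / prod c {1..k}))"
proof (induction n rule: induct_nat_012)
  case (ge2 n)
  have "prod c {1..n} \<noteq> 0" "c (Suc n) \<noteq> 0" "c (Suc (Suc n)) \<noteq> 0" "c (Suc (Suc (Suc n))) \<noteq> 0"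
    using assms by auto
  then show ?case
    unfolding cf_denom.simps ge2 by (simp add: field_simps)
qed (use assms in \<open>auto simp: field_simps numeral_2_eq_2\<close>)

text \<open>The left side inherits the three-term recurrence by linearity. The products
  \<open>p n = prod c {1..Suc n}\<close> obey it too: the term \<open>- p (n-1)\<close> is cancelled
  by \<open>c n * p (n-2) = p (n-1)\<close>.\<close>

lemma cf_num_euler:
  fixes c :: "nat \<Rightarrow> 'a::real_normed_field"
  shows "cf_num c (\<lambda>n. c (Suc n) - 1) n + c 1 * cf_denom c (\<lambda>n. c (Suc n) - 1) n =
    prod c {1..Suc n}"
proof (induction n rule: induct_nat_012)
  case (ge2 n)
  let ?A = "cf_num c (\<lambda>n. c (Suc n) - 1)" and ?B = "cf_denom c (\<lambda>n. c (Suc n) - 1)"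
  have "?A (Suc (Suc n)) + c 1 * ?B (Suc (Suc n)) =
      (c (Suc (Suc (Suc n))) - 1) * (?A (Suc n) + c 1 * ?B (Suc n))
      + c (Suc (Suc n)) * (?A n + c 1 * ?B n)"
    by (simp add: algebra_simps)
  also have "\<dots> = prod c {1..Suc (Suc (Suc n))}"
    unfolding ge2 by (simp add: algebra_simps)
  finally show ?case .
qed (auto simp: algebra_simps numeral_2_eq_2)

text \<open>Dividing the numerator identity by the denominators gives \<open>c 1\<close> plus the
  convergent as the reciprocal of \<open>T\<close>. The series starts at \<open>k = 0\<close> with
  the empty product, so its first term 1 is the one removed in \<open>1 - s\<close>.\<close>

lemma cf_euler:
  fixes c :: "nat \<Rightarrow> 'a::real_normed_field"
  assumes c: "\<And>n. n > 0 \<Longrightarrow> c n \<noteq> 0"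
    and s: "(\<lambda>k. (-1) ^ k / prod c {1..k}) sums s" "s \<noteq> 1"
  shows "cf_convergent c (\<lambda>n. c (Suc n) - 1)"
    and "c 1 + cf_value c (\<lambda>n. c (Suc n) - 1) = 1 / (1 - s)"
proof -
  let ?A = "cf_num c (\<lambda>n. c (Suc n) - 1)" and ?B = "cf_denom c (\<lambda>n. c (Suc n) - 1)"
  define T where "T n = 1 - (\<Sum>k\<le>Suc n. (-1) ^ k / prod c {1..k})" for n
  have T: "T \<longlonglongrightarrow> 1 - s"
    using s(1) unfolding T_def sums_def_le
    by (intro tendsto_diff tendsto_const LIMSEQ_Suc)
  then have nz: "\<forall>\<^sub>F n in sequentially. T n \<noteq> 0"
    using s(2) by (intro tendsto_imp_eventually_ne) auto
  have P: "prod c {1..Suc n} \<noteq> 0" for n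
    using c by (auto simp del: prod.cl_ivl_Suc)
  have B: "?B n = prod c {1..Suc n} * T n" for n
    unfolding T_def by (rule cf_denom_euler[OF c])
  have nzB: "\<forall>\<^sub>F n in sequentially. ?B n \<noteq> 0"
    using nz by eventually_elim (use P B in \<open>simp del: prod.cl_ivl_Suc\<close>)
  have "(\<lambda>n. 1 / T n - c 1) \<longlonglongrightarrow> 1 / (1 - s) - c 1"
    using s(2) by (intro tendsto_intros T) auto
  moreover have "\<forall>\<^sub>F n in sequentially. 1 / T n - c 1 = ?A n / ?B n"
    using nz
  proof eventually_elim
    case (elim n)
    have A: "?A n = prod c {1..Suc n} - c 1 * ?B n"
      using cf_num_euler[of c n] by (simp add: algebra_simps)
    then show ?case
      using elim P[of n] unfolding A B by (simp add: diff_divide_distrib del: prod.cl_ivl_Suc)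
  qed
  ultimately have lim: "(\<lambda>n. ?A n / ?B n) \<longlonglongrightarrow> 1 / (1 - s) - c 1"
    by (rule Lim_transform_eventually)
  show "cf_convergent c (\<lambda>n. c (Suc n) - 1)"
    unfolding cf_convergent_def using nzB lim by (auto simp: convergent_def)
  show "c 1 + cf_value c (\<lambda>n. c (Suc n) - 1) = 1 / (1 - s)"
    unfolding cf_value_def using limI[OF lim] by simp
qed

definition bessel_coeff :: "nat \<Rightarrow> nat \<Rightarrow> real" where
  "bessel_coeff \<nu> k = (-1) ^ k * fact \<nu> / (fact k * fact (k + \<nu>))"

text \<open>The hypergeometric function 0F1(; \<nu> + 1; -t), entire in t, so that the energy
  argument can start at t = 0.\<close>

definition bessel_norm :: "nat \<Rightarrow> real \<Rightarrow> real" where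
  "bessel_norm \<nu> t = (\<Sum>k. bessel_coeff \<nu> k * t ^ k)"

text \<open>This recurrence is the differential equation of \<open>bessel_norm\<close> read
  coefficientwise; it also yields the product form of the terms.\<close>

lemma bessel_coeff_Suc:
  "real (Suc k) * (real k + real \<nu> + 1) * bessel_coeff \<nu> (Suc k) = - bessel_coeff \<nu> k"
proof -
  have "real k + real \<nu> + 1 \<noteq> 0" "real (Suc k) \<noteq> 0" by auto
  then show ?thesis
    by (simp add: bessel_coeff_def divide_simps)
qed

lemma summable_bessel_norm: "summable (\<lambda>k. bessel_coeff \<nu> k * t ^ k)"
proof (rule summable_comparison_test')
  show "summable (\<lambda>k. inverse (fact k) * \<bar>t\<bar> ^ k)"
    by (rule summable_exp)
  fix k :: nat
  have "fact \<nu> / fact (k + \<nu>) \<le> (1::real)"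
    by (simp add: fact_mono)
  then have "fact \<nu> / fact (k + \<nu>) * (inverse (fact k) * \<bar>t\<bar> ^ k)
      \<le> 1 * (inverse (fact k) * \<bar>t\<bar> ^ k)"
    by (rule mult_right_mono) simp
  then show "norm (bessel_coeff \<nu> k * t ^ k) \<le> inverse (fact k) * \<bar>t\<bar> ^ k"
    by (simp add: bessel_coeff_def abs_mult power_abs field_simps)
qed

lemma bessel_norm_less_one:
  assumes "t > 0"
  shows "bessel_norm \<nu> t < 1"
proof -
  let ?u = "bessel_coeff \<nu>"
  define g' where "g' t = (\<Sum>k. diffs ?u k * t ^ k)" for t
  define g'' where "g'' t = (\<Sum>k. diffs (diffs ?u) k * t ^ k)" for t
  have sum': "summable (\<lambda>k. diffs ?u k * t ^ k)" for t
    using summable_bessel_norm by (rule termdiff_converges_all)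
  have sum'': "summable (\<lambda>k. diffs (diffs ?u) k * t ^ k)" for t
    using sum' by (rule termdiff_converges_all)
  have dg: "(bessel_norm \<nu> has_field_derivative g' t) (at t)" for t
    unfolding bessel_norm_def[abs_def] g'_def
    by (rule termdiffs_strong_converges_everywhere[OF summable_bessel_norm])
  have dg': "(g' has_field_derivative g'' t) (at t)" for t
    unfolding g'_def[abs_def] g''_def
    by (rule termdiffs_strong_converges_everywhere[OF sum'])
  have ode: "t * g'' t + (real \<nu> + 1) * g' t + bessel_norm \<nu> t = 0" for t
  proof -
    have "(\<lambda>k. t * (diffs (diffs ?u) k * t ^ k)) sums (t * g'' t)"
      unfolding g''_def by (intro sums_mult summable_sums sum'')
    then have "(\<lambda>k. real (Suc k) * diffs ?u (Suc k) * t ^ Suc k) sums (t * g'' t)"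
      by (simp add: diffs_def mult_ac)
    \<comment> \<open>Index shift: the new term at \<open>k = 0\<close> vanishes because of the
      factor \<open>real k\<close>.\<close>
    then have "(\<lambda>k. real k * diffs ?u k * t ^ k) sums (t * g'' t)"
      by (subst (asm) sums_Suc_iff) simp
    moreover have "(\<lambda>k. (real \<nu> + 1) * (diffs ?u k * t ^ k)) sums ((real \<nu> + 1) * g' t)"
      unfolding g'_def by (intro sums_mult summable_sums sum')
    moreover have "(\<lambda>k. ?u k * t ^ k) sums bessel_norm \<nu> t"
      unfolding bessel_norm_def by (intro summable_sums summable_bessel_norm)
    ultimately have "(\<lambda>k. real k * diffs ?u k * t ^ k + (real \<nu> + 1) * (diffs ?u k * t ^ k)
        + ?u k * t ^ k) sums (t * g'' t + (real \<nu> + 1) * g' t + bessel_norm \<nu> t)"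
      by (intro sums_add)
    moreover have "real k * diffs ?u k * t ^ k + (real \<nu> + 1) * (diffs ?u k * t ^ k)
        + ?u k * t ^ k = 0" for k
    proof -
      have "real k * diffs ?u k * t ^ k + (real \<nu> + 1) * (diffs ?u k * t ^ k) + ?u k * t ^ k
          = (real (Suc k) * (real k + real \<nu> + 1) * ?u (Suc k) + ?u k) * t ^ k"
        by (simp add: diffs_def algebra_simps)
      then show ?thesis
        by (simp only: bessel_coeff_Suc) simp
    qed
    ultimately have "(\<lambda>k. 0) sums (t * g'' t + (real \<nu> + 1) * g' t + bessel_norm \<nu> t)"
      by (simp only:)
    then show ?thesis
      by (rule sums_unique2[OF _ sums_zero])
  qed
  define E where "E t = (bessel_norm \<nu> t)\<^sup>2 + t * (g' t)\<^sup>2" for t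
  have dE: "(E has_field_derivative - (2 * real \<nu> + 1) * (g' t)\<^sup>2) (at t)" for t
  proof -
    have "(E has_field_derivative 2 * bessel_norm \<nu> t * g' t + ((g' t)\<^sup>2 + t * (2 * g' t * g'' t))) (at t)"
      unfolding E_def[abs_def]
      by (rule derivative_eq_intros dg dg' refl | simp add: algebra_simps)+
    \<comment> \<open>Substituting
      \<open>t * g'' t + bessel_norm \<nu> t = - (\<nu> + 1) * g' t\<close> from \<open>ode\<close>
      leaves only a multiple of the square of \<open>g' t\<close>.\<close>
    moreover have "2 * bessel_norm \<nu> t * g' t + ((g' t)\<^sup>2 + t * (2 * g' t * g'' t))
        = - (2 * real \<nu> + 1) * (g' t)\<^sup>2"
      using ode[of t] by algebra
    ultimately show ?thesis by simp
  qed
  have g0: "bessel_norm \<nu> 0 = 1"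
    unfolding bessel_norm_def by (subst powser_zero) (simp add: bessel_coeff_def)
  then have E0: "E 0 = 1"
    by (simp add: E_def)
  \<comment> \<open>The derivative of \<open>E\<close> is only known to be nonpositive in general.
    Strictness comes from the origin, where \<open>ode\<close> reduces to
    \<open>(\<nu> + 1) * g' 0 = -1\<close>, so \<open>E\<close> drops at once.\<close>
  have "g' 0 \<noteq> 0"
    using ode[of 0] g0 by auto
  then have "- (2 * real \<nu> + 1) * (g' 0)\<^sup>2 < 0"
    by (simp add: mult_less_0_iff add_pos_nonneg)
  from DERIV_neg_dec_right[OF dE this] obtain d
    where d: "d > 0" "\<And>h. h > 0 \<Longrightarrow> h < d \<Longrightarrow> E h < E 0" by auto
  \<comment> \<open>A point in the interval of strict decrease that does not lie beyond
    \<open>t\<close>; from there on monotonicity suffices.\<close>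
  define h where "h = min (d / 2) t"
  have "E t \<le> E h"
  proof (rule DERIV_nonpos_imp_nonincreasing[where f = E])
    show "h \<le> t" by (simp add: h_def)
    fix x
    show "\<exists>y. (E has_field_derivative y) (at x) \<and> y \<le> 0"
      by (intro exI conjI, rule dE) (simp add: mult_nonpos_nonneg)
  qed
  also have "E h < 1"
    using d(2)[of h] d(1) assms E0 by (auto simp: h_def)
  finally have "(bessel_norm \<nu> t)\<^sup>2 < 1"
    using assms by (auto simp: E_def intro: le_less_trans[rotated])
  then show ?thesis
    by (simp add: abs_square_less_1)
qed

text \<open>The prefactor cancels the power \<nu> of 1/(2m) in each term. Only even powers remain,
  so negative \<open>m\<close> is covered as well.\<close>

lemma bessel_J_eq_bessel_norm:
  assumes "m \<noteq> 0"
  shows "fact \<nu> * (2 * m) ^ \<nu> * bessel_J \<nu> (1 / m) = bessel_norm \<nu> (1 / (2 * m)\<^sup>2)"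
proof -
  have "fact \<nu> * (2 * m) ^ \<nu> * ((-1) ^ k / (fact k * fact (k + \<nu>)) * (1 / m / 2) ^ (2 * k + \<nu>))
      = bessel_coeff \<nu> k * (1 / (2 * m)\<^sup>2) ^ k" for k
  proof -
    have "(1 / m / 2) ^ (2 * k + \<nu>) = (1 / (2 * m)\<^sup>2) ^ k / (2 * m) ^ \<nu>"
      by (simp add: power_add power_mult power_divide power_mult_distrib)
    then show ?thesis
      using assms by (simp add: bessel_coeff_def)
  qed
  then show ?thesis
    unfolding bessel_J_def bessel_norm_def
    by (subst suminf_mult[OF summable_bessel_J, symmetric]) simp
qed

text \<open>The ratio of consecutive terms is -1 over the next factor of the product, which
  identifies the Bessel series with the series of \<open>cf_euler\<close>.\<close>

lemma bessel_coeff_eq_prod: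
  assumes "m \<noteq> 0"
  shows "bessel_coeff \<nu> k * (1 / (2 * m)\<^sup>2) ^ k =
    (-1) ^ k / (\<Prod>n = 1..k. 4 * m\<^sup>2 * real n * (real n + real \<nu>))"
proof (induction k)
  case (Suc k)
  have *: "bessel_coeff \<nu> (Suc k) = - bessel_coeff \<nu> k / (real (Suc k) * (real k + real \<nu> + 1))"
  proof (rule eq_divide_imp)
    have "real k + real \<nu> + 1 \<noteq> 0" by linarith
    then show "real (Suc k) * (real k + real \<nu> + 1) \<noteq> 0" by auto
    show "bessel_coeff \<nu> (Suc k) * (real (Suc k) * (real k + real \<nu> + 1)) = - bessel_coeff \<nu> k"
      using bessel_coeff_Suc by (simp only: mult.commute)
  qed
  have "bessel_coeff \<nu> (Suc k) * (1 / (2 * m)\<^sup>2) ^ Suc k =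
      (bessel_coeff \<nu> k * (1 / (2 * m)\<^sup>2) ^ k)
      * (- 1 / (4 * m\<^sup>2 * real (Suc k) * (real (Suc k) + real \<nu>)))"
    unfolding * by (simp add: power_mult_distrib mult_ac add_ac)
  then show ?case
    unfolding Suc by simp
qed (simp add: bessel_coeff_def)

theorem corollary9:
  fixes \<nu> :: nat and m :: real and a b :: "nat \<Rightarrow> real"
  defines "a \<equiv> \<lambda>n. 4 * m\<^sup>2 * real n * (real n + real \<nu>)"
    and "b \<equiv> \<lambda>n. 4 * m\<^sup>2 * (real n + 1) * (real n + real \<nu> + 1) - 1"
  assumes "\<nu> > 0" and "m \<noteq> 0"
  shows "cf_convergent a b \<and>
    1 - fact \<nu> * (2 * m) ^ \<nu> * bessel_J \<nu> (1 / m) \<noteq> 0 \<and>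
    4 * (real \<nu> + 1) * m\<^sup>2 + cf_value a b =
      1 / (1 - fact \<nu> * (2 * m) ^ \<nu> * bessel_J \<nu> (1 / m))"
proof -
  define s where "s = fact \<nu> * (2 * m) ^ \<nu> * bessel_J \<nu> (1 / m)"
  have s: "s = bessel_norm \<nu> (1 / (2 * m)\<^sup>2)"
    unfolding s_def using \<open>m \<noteq> 0\<close> by (rule bessel_J_eq_bessel_norm)
  have s1: "s \<noteq> 1"
    unfolding s using bessel_norm_less_one[of "1 / (2 * m)\<^sup>2" \<nu>] \<open>m \<noteq> 0\<close> by simp
  have b: "b = (\<lambda>n. a (Suc n) - 1)"
    by (simp add: a_def b_def add_ac)
  have a0: "a n \<noteq> 0" if "n > 0" for n
  proof -
    have "real n + real \<nu> \<noteq> 0" using that by linarith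
    with that \<open>m \<noteq> 0\<close> show ?thesis by (simp add: a_def)
  qed
  have sums: "(\<lambda>k. (-1) ^ k / prod a {1..k}) sums s"
    using summable_sums[OF summable_bessel_norm[of \<nu> "1 / (2 * m)\<^sup>2"]]
    unfolding bessel_coeff_eq_prod[OF \<open>m \<noteq> 0\<close>] s bessel_norm_def a_def .
  have "4 * (real \<nu> + 1) * m\<^sup>2 = a 1"
    by (simp add: a_def)
  then show ?thesis
    using cf_euler[OF a0 sums s1] s1 unfolding b s_def by simp
qed

end
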